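(* Let $\mathcal I$ be a maximal ideal on an infinite set $X$, let $\nu=\mathtt{non}(\mathcal I)$, and let $\kappa$ denote a cardinal. (a) If $\omega\le\kappa\le\nu$, then $\mathtt{cof}^{[X]^{<\kappa}}(\mathcal I)\ge\omega_1$. (b) If $\nu<\kappa\le|X|$, then $\mathtt{cof}^{[X]^{<\kappa}}(\mathcal I)=1$. (c) If $\kappa\ge\omega$ and $\nu^{<\kappa}<\mathtt{cof}(\mathcal I)$, then $\mathtt{cof}^{[X]^{<\kappa}}(\mathcal I)=\mathtt{cof}(\mathcal I)$. (d) $\mathtt{cof}^{*}(\mathcal I)=\mathtt{cof}(\mathcal I)>\nu$.
   Context: An ideal on an infinite set $X$ is a family $\mathcal I\subseteq\mathcal P(X)$ closed under subsets and finite unions, with $X\notin\mathcal I$ and $[X]^{<\omega}\subseteq\mathcal I$; maximal means maximal under inclusion among ideals on $X$. $[X]^{<\kappa}$ is the family of subsets of $X$ of cardinality $<\kappa$, and $\nu^{<\kappa}=\sup_{\lambda<\kappa}\nu^\lambda$ ($\lambda$ ranging over cardinals). $\mathtt{non}(\mathcal I)=\min\{|A|:A\subseteq X,\ A\notin\mathcal I\}$; $\mathtt{cof}(\mathcal I)=\min\{|\mathcal B|:\mathcal B\subseteq\mathcal I,\ \forall I\in\mathcal I\ \exists B\in\mathcal B\ I\subseteq B\}$; $\mathtt{cof}^{\mathcal J}(\mathcal I)=\min\{|\mathcal A|:\mathcal A\subseteq\mathcal I,\ \forall I\in\mathcal I\ \exists A\in\mathcal A\ I\setminus A\in\mathcal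 J\}$; $\mathtt{cof}^*(\mathcal I)=\mathtt{cof}^{[X]^{<\omega}}(\mathcal I)$. *)

theory Defs
  imports Main
begin

unbundle cardinal_syntax

definition ideal_on :: "'a set \<Rightarrow> 'a set set \<Rightarrow> bool" where
  "ideal_on X I \<longleftrightarrow>
     I \<subseteq> Pow X \<and>
     (\<forall>A\<in>I. \<forall>B. B \<subseteq> A \<longrightarrow> B \<in> I) \<and>
     (\<forall>F. finite F \<and> F \<subseteq> I \<longrightarrow> \<Union>F \<in> I) \<and>
     X \<notin> I \<and>
     (\<forall>A. A \<subseteq> X \<and> finite A \<longrightarrow> A \<in> I)"

definition maximal_ideal_on :: "'a set \<Rightarrow> 'a set set \<Rightarrow> bool" where
  "maximal_ideal_on X I \<longleftrightarrow>
     ideal_on X I \<and> (\<forall>J. ideal_on X J \<and> I \<subseteq> J \<longrightarrow> J = I)"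

text \<open>Cardinals are well-order relations satisfying \<^term>\<open>Card_order\<close>, compared by \<open>\<le>o\<close>, \<open><o\<close> and
  \<open>=o\<close> across types. The minimum of a nonempty set of cardinals is determined only up to \<open>=o\<close>; the
  choice operator picks a representative.\<close>

definition min_card :: "'a rel set \<Rightarrow> 'a rel" where
  "min_card R = (SOME r. r \<in> R \<and> (\<forall>r'\<in>R. r \<le>o r'))"

lemma min_card:
  assumes "R \<noteq> {}" and "\<forall>r\<in>R. Card_order r"
  shows "min_card R \<in> R" and "\<forall>r\<in>R. min_card R \<le>o r"
proof -
  have "\<exists>r. r \<in> R \<and> (\<forall>r'\<in>R. r \<le>o r')"
    using exists_minim_Card_order[OF assms] by blast
  then have "min_card R \<in> R \<and> (\<forall>r\<in>R. min_card R \<le>o r)"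
    unfolding min_card_def by (rule someI_ex)
  then show "min_card R \<in> R" and "\<forall>r\<in>R. min_card R \<le>o r" by auto
qed

definition subsets_less :: "'a set \<Rightarrow> 'k rel \<Rightarrow> 'a set set" where
  "subsets_less X \<kappa> = {A. A \<subseteq> X \<and> |A| <o \<kappa>}"

definition non_ideal :: "'a set \<Rightarrow> 'a set set \<Rightarrow> 'a rel" where
  "non_ideal X I = min_card {|A| | A. A \<subseteq> X \<and> A \<notin> I}"

definition cof_ideal :: "'a set set \<Rightarrow> 'a set rel" where
  "cof_ideal I = min_card {|B| | B. B \<subseteq> I \<and> (\<forall>S\<in>I. \<exists>T\<in>B. S \<subseteq> T)}"

definition cof_mod :: "'a set set \<Rightarrow> 'a set set \<Rightarrow> 'a set rel" where
  "cof_mod J I = min_card {|A| | A. A \<subseteq> I \<and> (\<forall>S\<in>I. \<exists>T\<in>A. S - T \<in> J)}"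

definition cof_star :: "'a set \<Rightarrow> 'a set set \<Rightarrow> 'a set rel" where
  "cof_star X I = cof_mod (subsets_less X natLeq) I"

text \<open>The weak power \<open>\<nu>\<close> to the \<open><\<kappa>\<close>: the least upper bound of the cardinals \<open>\<nu> ^c l\<close> for cardinals
  \<open>l <o \<kappa>\<close>. Up to \<open>=o\<close>, every cardinal below \<open>\<kappa>\<close> lives on the type of \<open>\<kappa>\<close>, and the supremum
  lives on the type of \<open>\<nu> ^c \<kappa>\<close>; the lemmas below show that fixing these types is harmless.\<close>

definition weak_power :: "'a rel \<Rightarrow> 'k rel \<Rightarrow> ('k \<Rightarrow> 'a) rel" where
  "weak_power \<nu> \<kappa> = min_card {\<mu>. Card_order \<mu> \<and>
     (\<forall>l :: 'k rel. Card_order l \<and> l <o \<kappa> \<longrightarrow> \<nu> ^c l \<le>o \<mu>)}"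

lemma weak_power:
  fixes \<nu> :: "'a rel" and \<kappa> :: "'k rel"
  shows Card_order_weak_power: "Card_order (weak_power \<nu> \<kappa>)"
    and weak_power_ub_aux: "\<forall>l :: 'k rel. Card_order l \<and> l <o \<kappa> \<longrightarrow> \<nu> ^c l \<le>o weak_power \<nu> \<kappa>"
    and weak_power_least_aux: "\<And>\<mu> :: ('k \<Rightarrow> 'a) rel. Card_order \<mu> \<Longrightarrow>
      \<forall>l :: 'k rel. Card_order l \<and> l <o \<kappa> \<longrightarrow> \<nu> ^c l \<le>o \<mu> \<Longrightarrow> weak_power \<nu> \<kappa> \<le>o \<mu>"
proof -
  define R where "R = {\<mu> :: ('k \<Rightarrow> 'a) rel. Card_order \<mu> \<and>
     (\<forall>l :: 'k rel. Card_order l \<and> l <o \<kappa> \<longrightarrow> \<nu> ^c l \<le>o \<mu>)}"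
  have "|UNIV :: ('k \<Rightarrow> 'a) set| \<in> R"
    unfolding R_def cexp_def by (simp add: card_of_Card_order card_of_mono1)
  then have ne: "R \<noteq> {}" and co: "\<forall>r\<in>R. Card_order r" unfolding R_def by auto
  have w: "weak_power \<nu> \<kappa> = min_card R" unfolding weak_power_def R_def ..
  have "weak_power \<nu> \<kappa> \<in> R" unfolding w by (rule min_card(1)[OF ne co])
  then show "Card_order (weak_power \<nu> \<kappa>)"
    and "\<forall>l :: 'k rel. Card_order l \<and> l <o \<kappa> \<longrightarrow> \<nu> ^c l \<le>o weak_power \<nu> \<kappa>"
    unfolding R_def by auto
  show "weak_power \<nu> \<kappa> \<le>o \<mu>" if "Card_order \<mu>"
    "\<forall>l :: 'k rel. Card_order l \<and> l <o \<kappa> \<longrightarrow> \<nu> ^c l \<le>o \<mu>" for \<mu> :: "('k \<Rightarrow> 'a) rel"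
    using min_card(2)[OF ne co] that unfolding w R_def by auto
qed

lemma weak_power_upper:
  fixes \<nu> :: "'a rel" and \<kappa> :: "'k rel" and l :: "'l rel"
  assumes "Card_order \<nu>" and "Card_order l" and "l <o \<kappa>"
  shows "\<nu> ^c l \<le>o weak_power \<nu> \<kappa>"
proof -
  obtain p :: "'k rel" where p: "l =o p" "p <o \<kappa>"
    using internalize_ordLess[of l \<kappa>] assms(3) by blast
  then have cp: "Card_order p" using Card_order_ordIso2 assms(2) by blast
  have "\<nu> ^c l =o \<nu> ^c p"
    by (rule cexp_cong2[OF p(1) assms(1,2)])
  then have "\<nu> ^c l \<le>o \<nu> ^c p" using ordIso_iff_ordLeq by blast
  then show ?thesis
    using weak_power_ub_aux p(2) cp ordLeq_transitive by blast
qed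

lemma weak_power_least:
  fixes \<nu> :: "'a rel" and \<kappa> :: "'k rel" and \<mu> :: "'m rel"
  assumes mu: "Card_order \<mu>"
    and ub: "\<forall>l :: 'k rel. Card_order l \<and> l <o \<kappa> \<longrightarrow> \<nu> ^c l \<le>o \<mu>"
  shows "weak_power \<nu> \<kappa> \<le>o \<mu>"
proof (cases "\<mu> \<le>o weak_power \<nu> \<kappa>")
  case True
  then obtain p :: "('k \<Rightarrow> 'a) rel" where p: "\<mu> =o p"
    using internalize_ordLeq[of \<mu> "weak_power \<nu> \<kappa>"] by blast
  then have "Card_order p" using Card_order_ordIso2 mu by blast
  moreover have "\<forall>l :: 'k rel. Card_order l \<and> l <o \<kappa> \<longrightarrow> \<nu> ^c l \<le>o p"
    using ub p ordLeq_ordIso_trans by blast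
  ultimately have "weak_power \<nu> \<kappa> \<le>o p" by (rule weak_power_least_aux)
  then show ?thesis using p ordIso_symmetric ordLeq_ordIso_trans by blast
next
  case False
  have "Well_order \<mu>" and "Well_order (weak_power \<nu> \<kappa>)"
    using mu Card_order_weak_power[of \<nu> \<kappa>] by (auto intro: card_order_on_well_order_on)
  with False show ?thesis using ordLeq_total by metis
qed

end

theory Submission
  imports Defs
begin

text \<open>Part (a) holds in the stronger form that the cofinality modulo sets of size less than \<open>\<kappa>\<close>
  exceeds \<open>\<kappa>\<close>. For \<open>\<kappa> = \<nu>\<close> this yields \<open>\<nu> < cof(I)\<close>. For (c), fix \<open>D \<notin> I\<close> of size \<open>\<nu>\<close>;
  its complement is in \<open>I\<close>, so only the subsets of \<open>D\<close> of size less than \<open>\<kappa>\<close> are needed to turn a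
  family cofinal modulo small sets into a cofinal one. As \<open>D\<close> has just \<open>\<nu>\<close> finite subsets, the
  same argument with \<open>\<kappa> = \<omega>\<close> gives (d).\<close>

section \<open>Disjoint sets by transfinite selection\<close>

text \<open>Choose the values by transfinite recursion along a well-order of \<open>J\<close> of
  minimal type. A proper initial segment is smaller than \<open>J\<close>, so the values chosen
  before stage \<open>j\<close> cannot exhaust \<open>B j\<close>.\<close>

lemma injective_selection:
  fixes B :: "'j \<Rightarrow> 'a set"
  assumes large: "\<And>j. j \<in> J \<Longrightarrow> |J| \<le>o |B j|"
  shows "\<exists>f. inj_on f J \<and> (\<forall>j\<in>J. f j \<in> B j)"
proof -
  define r where "r = |J|"
  have wo: "Well_order r" and fld: "Field r = J" and co: "Card_order r"
    unfolding r_def by (rule card_of_Well_order, rule Field_card_of, rule card_of_Card_order)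
  have wf: "wf (r - Id)" using wo by (simp add: well_order_on_def)
  define f where "f = wfrec (r - Id) (\<lambda>g j. SOME x. x \<in> B j - g ` underS r j)"
  have f: "f j = (SOME x. x \<in> B j - f ` underS r j)" for j
  proof -
    have "cut f (r - Id) j ` underS r j = f ` underS r j"
      \<comment> \<open>\<open>cut\<close> alters \<open>f\<close> only off the strict predecessors
        of \<open>j\<close>, and \<open>underS r j\<close> consists of exactly these.\<close>
      by (intro image_cong refl cut_apply) (auto simp: underS_def)
    then show ?thesis
      using wfrec[OF wf, of "\<lambda>g j. SOME x. x \<in> B j - g ` underS r j" j]
      unfolding f_def[symmetric] by simp
  qed
  have new: "f j \<in> B j - f ` underS r j" if j: "j \<in> J" for j
  proof -
    have "|f ` underS r j| <o |B j|"
      using card_of_image[of f "underS r j"] card_of_underS[OF co] large[OF j] j fld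
        ordLeq_ordLess_trans ordLess_ordLeq_trans unfolding r_def by metis
    then have "\<not> B j \<subseteq> f ` underS r j"
      using card_of_mono1 not_ordLess_ordLeq by blast
    then have "\<exists>x. x \<in> B j - f ` underS r j" by blast
    then show ?thesis unfolding f[of j] by (rule someI_ex)
  qed
  have "inj_on f J"
  proof (rule inj_onI, rule ccontr)
    fix i j assume ij: "i \<in> J" "j \<in> J" "f i = f j" "i \<noteq> j"
    have "total_on (Field r) r" using wo by (simp add: well_order_on_def linear_order_on_def)
    then have "i \<in> underS r j \<or> j \<in> underS r i"
      using ij fld by (auto simp: total_on_def underS_def)
    then show False using new[OF ij(1)] new[OF ij(2)] ij(3) by (metis DiffD2 imageI)
  qed
  then show ?thesis using new by blast
qed

text \<open>Ask every \<open>B\<close> in \<open>N\<close> for \<open>\<kappa>\<close> points for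
  \<open>S\<close> and \<open>\<kappa>\<close> points for \<open>T\<close>. These are at most
  \<open>\<kappa>\<close> requests, so one injective selection serves them all; injectivity makes
  the points of each \<open>B\<close> distinct and keeps \<open>S\<close> and \<open>T\<close>
  apart.\<close>

lemma disjoint_sets_meeting_largely:
  fixes \<kappa> :: "'k rel" and N :: "'a set set"
  assumes inf: "natLeq \<le>o \<kappa>" and co: "Card_order \<kappa>"
    and N: "|N| \<le>o \<kappa>" and large: "\<And>B. B \<in> N \<Longrightarrow> \<kappa> \<le>o |B|"
  shows "\<exists>S T. S \<union> T \<subseteq> \<Union>N \<and> S \<inter> T = {} \<and>
    (\<forall>B\<in>N. \<kappa> \<le>o |S \<inter> B| \<and> \<kappa> \<le>o |T \<inter> B| )"
proof -
  \<comment> \<open>The index \<open>(\<alpha>, B, b)\<close> requests the point number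
    \<open>\<alpha>\<close> of \<open>B\<close> for the set \<open>S b\<close>.\<close>
  define J where "J = Field \<kappa> \<times> N \<times> (UNIV :: bool set)"
  have infF: "infinite (Field \<kappa>)"
    using cinfinite_mono[OF inf natLeq_cinfinite] by (simp add: cinfinite_def)
  have F: "|Field \<kappa>| \<le>o \<kappa>" "\<kappa> \<le>o |Field \<kappa>|"
    using card_of_Field_ordIso[OF co] by (auto simp: ordIso_iff_ordLeq)
  have "|UNIV :: bool set| \<le>o \<kappa>"
    using Cfinite_ordLess_Cinfinite[of "|UNIV :: bool set|" \<kappa>] co infF
    by (simp add: cfinite_def cinfinite_def Field_card_of card_of_card_order_on ordLess_imp_ordLeq)
  then have "|J| \<le>o \<kappa>"
    unfolding J_def using infF co N F by (intro card_of_Times_ordLeq_infinite_Field)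
  then have "|J| \<le>o |fst (snd j)|" if "j \<in> J" for j
    using large that unfolding J_def by (auto intro: ordLeq_transitive)
  from injective_selection[of J "\<lambda>j. fst (snd j)", OF this]
  obtain f where f: "inj_on f J" "\<And>j. j \<in> J \<Longrightarrow> f j \<in> fst (snd j)" by blast
  define S where "S b = f ` (Field \<kappa> \<times> N \<times> {b})" for b
  have large_Int: "\<kappa> \<le>o |S b \<inter> B|" if "B \<in> N" for b B
  proof -
    let ?g = "\<lambda>\<alpha>. f (\<alpha>, B, b)"
    have "inj_on ?g (Field \<kappa>)"
      using f(1) that by (auto simp: inj_on_def J_def)
    moreover have "?g ` Field \<kappa> \<subseteq> S b \<inter> B"
      using f(2) that by (fastforce simp: S_def J_def)
    ultimately have "|Field \<kappa>| \<le>o |S b \<inter> B|" using card_of_ordLeq by blast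
    then show ?thesis using F(2) ordLeq_transitive by blast
  qed
  have disj: "S True \<inter> S False = {}"
    using inj_on_image_Int[OF f(1), of "Field \<kappa> \<times> N \<times> {True}" "Field \<kappa> \<times> N \<times> {False}"]
    unfolding S_def J_def by (simp add: Sigma_mono Times_Int_Times)
  have sub: "S b \<subseteq> \<Union>N" for b
    using f(2) unfolding S_def J_def by fastforce
  show ?thesis
    by (intro exI[of _ "S True"] exI[of _ "S False"] conjI ballI Un_least large_Int disj sub)
qed

section \<open>Counting small subsets\<close>

text \<open>Adding a point to an \<open>n\<close>-element set reaches all sets with
  \<open>n + 1\<close> elements, so by induction each finite size contributes at most
  \<open>|D|\<close> sets; then take a countable union.\<close>

lemma card_of_finite_subsets:
  assumes "infinite D"
  shows "|{F. F \<subseteq> D \<and> finite F}| \<le>o |D|"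
proof -
  let ?P = "\<lambda>n. {F. F \<subseteq> D \<and> finite F \<and> card F = n}"
  have "|?P n| \<le>o |D|" for n
  proof (induction n)
    case 0
    have "?P 0 = {{}}" by auto
    then show ?case using assms by (auto intro: card_of_singl_ordLeq)
  next
    case (Suc n)
    have "?P (Suc n) \<subseteq> (\<lambda>(x, F). insert x F) ` (D \<times> ?P n)"
      by (auto simp: card_Suc_eq image_iff)
    then have "|?P (Suc n)| \<le>o |D \<times> ?P n|"
      by (rule ordLeq_transitive[OF card_of_mono1 card_of_image])
    moreover have "|D \<times> ?P n| \<le>o |D|"
      using assms Suc
      by (intro card_of_Times_ordLeq_infinite_Field card_of_Card_order card_of_mono1 subset_refl)
        (simp_all add: Field_card_of)
    ultimately show ?case by (rule ordLeq_transitive)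
  qed
  moreover have "|UNIV :: nat set| \<le>o |D|"
    using assms by (simp add: infinite_iff_card_of_nat[symmetric])
  ultimately have "|\<Union>n\<in>UNIV. ?P n| \<le>o |D|"
    using assms by (intro card_of_UNION_ordLeq_infinite) auto
  moreover have "{F. F \<subseteq> D \<and> finite F} = (\<Union>n\<in>UNIV. ?P n)" by auto
  ultimately show ?thesis by simp
qed

text \<open>Otherwise the weak power \<open>\<mu>\<close> is itself a cardinal below
  \<open>\<kappa>\<close>, so it bounds \<open>\<nu> ^c \<mu>\<close>, against Cantor.\<close>

lemma ordLeq_weak_power:
  fixes \<nu> :: "'a rel" and \<kappa> :: "'k rel"
  assumes "ctwo \<le>o \<nu>" "Card_order \<nu>" "Card_order \<kappa>"
  shows "\<kappa> \<le>o weak_power \<nu> \<kappa>"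
proof (rule ccontr)
  let ?\<mu> = "weak_power \<nu> \<kappa>"
  have co: "Card_order ?\<mu>" by (rule Card_order_weak_power)
  assume "\<not> \<kappa> \<le>o ?\<mu>"
  then have "?\<mu> <o \<kappa>"
    using not_ordLeq_iff_ordLess[of ?\<mu> \<kappa>] co assms(3) by (auto simp: card_order_on_def)
  then have "\<nu> ^c ?\<mu> \<le>o ?\<mu>" by (rule weak_power_upper[OF assms(2) co])
  moreover have "?\<mu> <o \<nu> ^c ?\<mu>"
    using ordLess_ctwo_cexp[OF co] cexp_mono1[OF assms(1) co] ordLess_ordLeq_trans by blast
  ultimately show False using not_ordLess_ordLeq by blast
qed

text \<open>A set with fewer than \<open>\<kappa>\<close> elements is the image of a proper initial
  segment of \<open>\<kappa>\<close>. The functions on one segment number at most the weak power,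
  and so do the segments, by \<open>ordLeq_weak_power\<close>.\<close>

lemma card_of_subsets_less:
  fixes \<kappa> :: "'k rel"
  assumes inf: "natLeq \<le>o \<kappa>" and co: "Card_order \<kappa>" and D: "infinite D"
  shows "|subsets_less D \<kappa>| \<le>o weak_power (card_of D) \<kappa>"
proof -
  let ?\<mu> = "weak_power (card_of D) \<kappa>"
  let ?P = "\<lambda>\<alpha>. (\<lambda>f. f ` underS \<kappa> \<alpha>) ` Func (underS \<kappa> \<alpha>) D"
  have "ctwo \<le>o |D|"
    using D by (simp add: ctwo_ordLeq_Cinfinite cinfinite_def Field_card_of card_of_card_order_on)
  then have k: "\<kappa> \<le>o ?\<mu>" by (intro ordLeq_weak_power co card_of_Card_order)
  have wo: "Well_order \<kappa>" using co by (simp add: card_order_on_def)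
  have each: "|?P \<alpha>| \<le>o ?\<mu>" if "\<alpha> \<in> Field \<kappa>" for \<alpha>
  proof -
    have "|D| ^c |underS \<kappa> \<alpha>| \<le>o ?\<mu>"
      using card_of_underS[OF co that] by (intro weak_power_upper card_of_Card_order)
    then have "|Func (underS \<kappa> \<alpha>) D| \<le>o ?\<mu>" by (simp add: cexp_def Field_card_of)
    then show ?thesis using ordLeq_transitive[OF card_of_image] by blast
  qed
  have "subsets_less D \<kappa> \<subseteq> (\<Union>\<alpha>\<in>Field \<kappa>. ?P \<alpha>)"
  proof
    fix F assume "F \<in> subsets_less D \<kappa>"
    then have F: "F \<subseteq> D" "|F| <o \<kappa>" by (auto simp: subsets_less_def)
    then obtain \<alpha> where \<alpha>: "\<alpha> \<in> Field \<kappa>" "|F| =o Restr \<kappa> (underS \<kappa> \<alpha>)"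
      using ordLess_iff_ordIso_Restr[OF wo card_of_Well_order] by blast
    \<comment> \<open>Reflexivity keeps every point of the segment in the field of the restricted
      order.\<close>
    have "Field (Restr \<kappa> (underS \<kappa> \<alpha>)) = underS \<kappa> \<alpha>"
      using wo by (intro Refl_Field_Restr2)
        (auto simp: order_on_defs underS_def intro: FieldI1)
    with card_of_cong[OF \<alpha>(2)] have "|underS \<kappa> \<alpha>| =o |F|"
      by (simp add: Field_card_of ordIso_symmetric)
    then obtain g where g: "bij_betw g (underS \<kappa> \<alpha>) F" using card_of_ordIso by blast
    \<comment> \<open>Membership in \<open>Func\<close> demands the value \<open>undefined\<close>
      off the domain.\<close>
    define f where "f x = (if x \<in> underS \<kappa> \<alpha> then g x else undefined)" for x
    have "f \<in> Func (underS \<kappa> \<alpha>) D" "F = f ` underS \<kappa> \<alpha>"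
      using g F(1) by (auto simp: Func_def f_def bij_betw_def)
    then show "F \<in> (\<Union>\<alpha>\<in>Field \<kappa>. ?P \<alpha>)" using \<alpha>(1) by blast
  qed
  then have "|subsets_less D \<kappa>| \<le>o |\<Union>\<alpha>\<in>Field \<kappa>. ?P \<alpha>|" by (rule card_of_mono1)
  also have "|\<Union>\<alpha>\<in>Field \<kappa>. ?P \<alpha>| \<le>o ?\<mu>"
  proof (rule card_of_UNION_ordLeq_infinite_Field)
    show "infinite (Field ?\<mu>)"
      using cinfinite_mono[OF ordLeq_transitive[OF inf k] natLeq_cinfinite]
      by (simp add: cinfinite_def)
    show "|Field \<kappa>| \<le>o ?\<mu>"
      using card_of_Field_ordIso[OF co] k ordIso_ordLeq_trans by blast
  qed (use each Card_order_weak_power in auto)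
  finally show ?thesis .
qed

section \<open>Ideals and maximality\<close>

lemma
  assumes "ideal_on X I"
  shows ideal_on_subset: "A \<in> I \<Longrightarrow> B \<subseteq> A \<Longrightarrow> B \<in> I"
    and ideal_on_carrier: "A \<in> I \<Longrightarrow> A \<subseteq> X"
    and ideal_on_Un: "A \<in> I \<Longrightarrow> B \<in> I \<Longrightarrow> A \<union> B \<in> I"
    and ideal_on_proper: "X \<notin> I"
    and ideal_on_finite: "A \<subseteq> X \<Longrightarrow> finite A \<Longrightarrow> A \<in> I"
proof -
  note I = assms[unfolded ideal_on_def]
  show "A \<in> I \<Longrightarrow> B \<subseteq> A \<Longrightarrow> B \<in> I" "A \<in> I \<Longrightarrow> A \<subseteq> X" "X \<notin> I"
    "A \<subseteq> X \<Longrightarrow> finite A \<Longrightarrow> A \<in> I" using I by blast+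
  have "\<forall>F. finite F \<and> F \<subseteq> I \<longrightarrow> \<Union>F \<in> I" using I by blast
  from this[rule_format, of "{A, B}"]
  show "A \<in> I \<Longrightarrow> B \<in> I \<Longrightarrow> A \<union> B \<in> I" by simp
qed

text \<open>If \<open>X - A\<close> were also outside \<open>I\<close>, then \<open>J\<close>, the
  ideal generated by \<open>I\<close> and \<open>A\<close>, would be proper and strictly larger than
  \<open>I\<close>.\<close>

lemma maximal_ideal_on_Diff:
  assumes max: "maximal_ideal_on X I" and A: "A \<subseteq> X" "A \<notin> I"
  shows "X - A \<in> I"
proof (rule ccontr)
  assume XA: "X - A \<notin> I"
  have I: "ideal_on X I" using max by (simp add: maximal_ideal_on_def)
  define J where "J = {S. S \<subseteq> X \<and> S - A \<in> I}"
  have "ideal_on X J"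
    unfolding ideal_on_def
  proof (intro conjI ballI allI impI)
    fix F assume F: "finite F \<and> F \<subseteq> J"
    then have "finite ((\<lambda>S. S - A) ` F)" "(\<lambda>S. S - A) ` F \<subseteq> I" by (auto simp: J_def)
    then have "\<Union>((\<lambda>S. S - A) ` F) \<in> I" using I unfolding ideal_on_def by blast
    moreover have "\<Union>F - A = \<Union>((\<lambda>S. S - A) ` F)" by auto
    ultimately have "\<Union>F - A \<in> I" by (simp only:)
    moreover have "\<Union>F \<subseteq> X" using F unfolding J_def by blast
    ultimately show "\<Union>F \<in> J" unfolding J_def by blast
  next
    fix S T assume "S \<in> J" "T \<subseteq> S"
    then show "T \<in> J"
      using ideal_on_subset[OF I, of "S - A" "T - A"] by (auto simp: J_def)
  next
    fix S assume "S \<subseteq> X \<and> finite S"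
    then show "S \<in> J" using ideal_on_finite[OF I, of "S - A"] by (auto simp: J_def)
  qed (use XA in \<open>auto simp: J_def\<close>)
  moreover have "I \<subseteq> J"
    unfolding J_def using ideal_on_subset[OF I] ideal_on_carrier[OF I] by blast
  ultimately have "J = I" using max by (simp add: maximal_ideal_on_def)
  moreover have "A \<in> J" using A ideal_on_finite[OF I, of "{}"] by (simp add: J_def)
  ultimately show False using A by simp
qed

section \<open>The minima that define the cardinal invariants\<close>

lemma non_ideal_attained:
  assumes "ideal_on X I"
  obtains D where "D \<subseteq> X" "D \<notin> I" "infinite D" "non_ideal X I = |D|"
proof -
  let ?R = "{|A| | A. A \<subseteq> X \<and> A \<notin> I}"
  have "?R \<noteq> {}" using ideal_on_proper[OF assms] by blast
  moreover have "\<forall>r\<in>?R. Card_order r" by (auto intro: card_of_Card_order)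
  ultimately have "non_ideal X I \<in> ?R" unfolding non_ideal_def by (rule min_card(1))
  then show thesis using that ideal_on_finite[OF assms] by blast
qed

lemma non_ideal_le:
  assumes "A \<subseteq> X" "A \<notin> I"
  shows "non_ideal X I \<le>o |A|"
proof -
  let ?R = "{|A| | A. A \<subseteq> X \<and> A \<notin> I}"
  have "\<forall>r\<in>?R. Card_order r" by (auto intro: card_of_Card_order)
  then have "\<forall>r\<in>?R. non_ideal X I \<le>o r"
    unfolding non_ideal_def using assms by (intro min_card(2)) auto
  then show ?thesis using assms by blast
qed

lemma cof_ideal_attained:
  obtains B where "B \<subseteq> I" "\<forall>S\<in>I. \<exists>T\<in>B. S \<subseteq> T" "cof_ideal I = |B|"
proof -
  let ?R = "{|B| | B. B \<subseteq> I \<and> (\<forall>S\<in>I. \<exists>T\<in>B. S \<subseteq> T)}"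
  have "?R \<noteq> {}" by blast
  moreover have "\<forall>r\<in>?R. Card_order r" by (auto intro: card_of_Card_order)
  ultimately have "cof_ideal I \<in> ?R" unfolding cof_ideal_def by (rule min_card(1))
  then show thesis using that by blast
qed

lemma cof_ideal_le:
  assumes "B \<subseteq> I" "\<And>S. S \<in> I \<Longrightarrow> \<exists>T\<in>B. S \<subseteq> T"
  shows "cof_ideal I \<le>o |B|"
proof -
  let ?R = "{|B| | B. B \<subseteq> I \<and> (\<forall>S\<in>I. \<exists>T\<in>B. S \<subseteq> T)}"
  have B: "|B| \<in> ?R" using assms by blast
  have "\<forall>r\<in>?R. Card_order r" by (auto intro: card_of_Card_order)
  then have "\<forall>r\<in>?R. cof_ideal I \<le>o r"
    unfolding cof_ideal_def using B by (intro min_card(2)) auto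
  then show ?thesis using B by blast
qed

lemma cof_mod_attained:
  assumes "{} \<in> J"
  obtains A where "A \<subseteq> I" "\<forall>S\<in>I. \<exists>T\<in>A. S - T \<in> J" "cof_mod J I = |A|"
proof -
  let ?R = "{|A| | A. A \<subseteq> I \<and> (\<forall>S\<in>I. \<exists>T\<in>A. S - T \<in> J)}"
  \<comment> \<open>The family \<open>I\<close> itself is cofinal modulo \<open>J\<close>, so the
    minimum is over a nonempty set.\<close>
  have "\<forall>S\<in>I. \<exists>T\<in>I. S - T \<in> J" using assms by (metis Diff_cancel)
  then have "?R \<noteq> {}" by blast
  moreover have "\<forall>r\<in>?R. Card_order r" by (auto intro: card_of_Card_order)
  ultimately have "cof_mod J I \<in> ?R" unfolding cof_mod_def by (rule min_card(1))
  then show thesis using that by blast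
qed

lemma cof_mod_le:
  assumes "A \<subseteq> I" "\<And>S. S \<in> I \<Longrightarrow> \<exists>T\<in>A. S - T \<in> J"
  shows "cof_mod J I \<le>o |A|"
proof -
  let ?R = "{|A| | A. A \<subseteq> I \<and> (\<forall>S\<in>I. \<exists>T\<in>A. S - T \<in> J)}"
  have A: "|A| \<in> ?R" using assms by blast
  have "\<forall>r\<in>?R. Card_order r" by (auto intro: card_of_Card_order)
  then have "\<forall>r\<in>?R. cof_mod J I \<le>o r"
    unfolding cof_mod_def using A by (intro min_card(2)) auto
  then show ?thesis using A by blast
qed

lemma cof_mod_le_cof_ideal:
  assumes "{} \<in> J"
  shows "cof_mod J I \<le>o cof_ideal I"
proof -
  obtain B where B: "B \<subseteq> I" "\<forall>S\<in>I. \<exists>T\<in>B. S \<subseteq> T" "cof_ideal I = |B|"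
    using cof_ideal_attained by metis
  have "\<exists>T\<in>B. S - T \<in> J" if "S \<in> I" for S
    using B(2) that assms by (metis Diff_eq_empty_iff)
  then show ?thesis unfolding B(3) by (intro cof_mod_le B(1))
qed

lemma empty_in_subsets_less:
  fixes \<kappa> :: "'k rel"
  assumes "natLeq \<le>o \<kappa>"
  shows "{} \<in> subsets_less X \<kappa>"
proof -
  have "|{}| <o natLeq"
    by (rule Cfinite_ordLess_Cinfinite[OF _ natLeq_Cinfinite])
      (simp add: cfinite_def Field_card_of card_of_card_order_on)
  then show ?thesis using assms ordLess_ordLeq_trans by (auto simp: subsets_less_def)
qed

section \<open>Cofinality modulo small sets\<close>

text \<open>Given at most \<open>\<kappa>\<close> members of \<open>I\<close>, all their complements are large, so two disjoint sets
  meet every one of the complements in \<open>\<kappa>\<close> points; by maximality one of the two sets lies in \<open>I\<close>.\<close>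

lemma ordLess_cof_mod:
  fixes \<kappa> :: "'k rel"
  assumes max: "maximal_ideal_on X I" and co: "Card_order \<kappa>"
    and inf: "natLeq \<le>o \<kappa>" and le: "\<kappa> \<le>o non_ideal X I"
  shows "\<kappa> <o cof_mod (subsets_less X \<kappa>) I"
proof (rule ccontr)
  have I: "ideal_on X I" using max by (simp add: maximal_ideal_on_def)
  obtain A where A: "A \<subseteq> I" "\<forall>S\<in>I. \<exists>T\<in>A. S - T \<in> subsets_less X \<kappa>"
    "cof_mod (subsets_less X \<kappa>) I = |A|"
    using cof_mod_attained[OF empty_in_subsets_less[OF inf]] by metis
  assume "\<not> \<kappa> <o cof_mod (subsets_less X \<kappa>) I"
  then have "|A| \<le>o \<kappa>"
    using co A(3) not_ordLess_iff_ordLeq[of "|A|" \<kappa>]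
    by (auto simp: card_order_on_def card_of_Well_order)
  then have "|(\<lambda>T. X - T) ` A| \<le>o \<kappa>" using ordLeq_transitive[OF card_of_image] by blast
  \<comment> \<open>The complement of a member of \<open>I\<close> is outside \<open>I\<close>, so
    it has at least \<open>non_ideal X I\<close> points.\<close>
  moreover have "\<kappa> \<le>o |B|" if "B \<in> (\<lambda>T. X - T) ` A" for B
  proof -
    obtain T where T: "T \<in> A" "B = X - T" using \<open>B \<in> _\<close> by blast
    have "X - T \<notin> I"
    proof
      assume "X - T \<in> I"
      then have "X - T \<union> T \<in> I" using T A(1) ideal_on_Un[OF I] by blast
      then show False using ideal_on_subset[OF I, of _ X] ideal_on_proper[OF I] by blast
    qed
    then show ?thesis using T non_ideal_le[of B X I] le ordLeq_transitive by blast
  qed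
  ultimately obtain S T where ST: "S \<union> T \<subseteq> \<Union>((\<lambda>T. X - T) ` A)" "S \<inter> T = {}"
    "\<forall>B\<in>(\<lambda>T. X - T) ` A. \<kappa> \<le>o |S \<inter> B| \<and> \<kappa> \<le>o |T \<inter> B|"
    using disjoint_sets_meeting_largely[OF inf co, of "(\<lambda>T. X - T) ` A"] by metis
  have sub: "S \<subseteq> X" "T \<subseteq> X" using ST(1) by auto
  \<comment> \<open>Such a \<open>U\<close> has \<open>\<kappa>\<close> points outside each
    \<open>T\<close> in \<open>A\<close>, so no \<open>T\<close> covers it modulo small
    sets.\<close>
  have no: "U \<notin> I" if U: "U \<subseteq> X" "\<forall>B\<in>(\<lambda>T. X - T) ` A. \<kappa> \<le>o |U \<inter> B|" for U
  proof
    assume "U \<in> I"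
    then obtain T where T: "T \<in> A" "|U - T| <o \<kappa>" using A(2) by (auto simp: subsets_less_def)
    moreover have "U \<inter> (X - T) = U - T" using U(1) by auto
    ultimately have "\<kappa> \<le>o |U - T|" using U(2) by auto
    then show False using T(2) not_ordLess_ordLeq by blast
  qed
  have "S \<notin> I" "T \<notin> I" using no[OF sub(1)] no[OF sub(2)] ST(3) by blast+
  \<comment> \<open>Disjointness places \<open>T\<close> inside \<open>X - S\<close>.\<close>
  then have "X - S \<in> I" using maximal_ideal_on_Diff[OF max sub(1)] by simp
  then show False using \<open>T \<notin> I\<close> ideal_on_subset[OF I, of "X - S" T] ST(2) sub by blast
qed

text \<open>If \<open>D\<close> is not in \<open>I\<close> and \<open>A\<close> is cofinal modulo \<open>subsets_less X \<kappa>\<close>, then the sets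
  \<open>T \<union> (X - D) \<union> F\<close> with \<open>T \<in> A\<close> and \<open>F \<in> I\<close> a subset of \<open>D\<close> of size less than \<open>\<kappa>\<close> are cofinal.\<close>

lemma cof_mod_eq_cof_ideal:
  fixes \<kappa> :: "'k rel" and \<mu> :: "'m rel"
  assumes max: "maximal_ideal_on X I" and D: "D \<subseteq> X" "D \<notin> I"
    and inf: "natLeq \<le>o \<kappa>" and mu: "Cinfinite \<mu>"
    and P: "|subsets_less D \<kappa>| \<le>o \<mu>" and less: "\<mu> <o cof_ideal I"
  shows "cof_mod (subsets_less X \<kappa>) I =o cof_ideal I"
proof -
  have I: "ideal_on X I" using max by (simp add: maximal_ideal_on_def)
  have e: "{} \<in> subsets_less X \<kappa>" by (rule empty_in_subsets_less[OF inf])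
  obtain A where A: "A \<subseteq> I" "\<forall>S\<in>I. \<exists>T\<in>A. S - T \<in> subsets_less X \<kappa>"
    "cof_mod (subsets_less X \<kappa>) I = |A|"
    using cof_mod_attained[OF e] by metis
  \<comment> \<open>Subsets of \<open>D\<close> of size below \<open>\<kappa>\<close> may lie
    outside \<open>I\<close>, since \<open>\<kappa>\<close> is not bounded by
    \<open>non_ideal X I\<close>; the intersection keeps \<open>?B\<close> inside
    \<open>I\<close>.\<close>
  let ?P = "subsets_less D \<kappa> \<inter> I"
  let ?B = "(\<lambda>(T, F). T \<union> (X - D) \<union> F) ` (A \<times> ?P)"
  have "cof_ideal I \<le>o |?B|"
  proof (rule cof_ideal_le)
    show "?B \<subseteq> I"
      using A(1) maximal_ideal_on_Diff[OF max D] by (auto intro!: ideal_on_Un[OF I])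
    fix S assume S: "S \<in> I"
    then obtain T where T: "T \<in> A" "|S - T| <o \<kappa>" using A(2) by (auto simp: subsets_less_def)
    have "|(S - T) \<inter> D| <o \<kappa>"
      using T(2) card_of_mono1[of "(S - T) \<inter> D" "S - T"] ordLeq_ordLess_trans by blast
    then have "(S - T) \<inter> D \<in> ?P"
      using ideal_on_subset[OF I S, of "(S - T) \<inter> D"] by (auto simp: subsets_less_def)
    then have "T \<union> (X - D) \<union> ((S - T) \<inter> D) \<in> ?B"
      using T(1) by (intro image_eqI[of _ _ "(T, (S - T) \<inter> D)"]) simp_all
    moreover have "S \<subseteq> T \<union> (X - D) \<union> ((S - T) \<inter> D)"
      using ideal_on_carrier[OF I S] by auto
    ultimately show "\<exists>U\<in>?B. S \<subseteq> U" by (rule bexI[rotated])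
  qed
  then have B: "cof_ideal I \<le>o |A \<times> ?P|" by (rule ordLeq_transitive[OF _ card_of_image])
  have P': "|?P| \<le>o \<mu>" by (rule ordLeq_transitive[OF card_of_mono1 P]) simp
  have "cof_ideal I \<le>o |A|"
  \<comment> \<open>If \<open>A\<close> had size at most \<open>\<mu>\<close>, so would the cofinal
    family, against \<open>less\<close>. Otherwise \<open>A\<close> is infinite and absorbs the
    factor \<open>?P\<close>.\<close>
  proof (cases "|A| \<le>o \<mu>")
    case True
    then have "|A \<times> ?P| \<le>o \<mu>"
      using P' mu by (intro card_of_Times_ordLeq_infinite_Field) (auto simp: cinfinite_def)
    then have "cof_ideal I \<le>o \<mu>" using B ordLeq_transitive by blast
    then show ?thesis using less not_ordLess_ordLeq by blast
  next
    case False
    then have le: "\<mu> \<le>o |A|"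
      using mu not_ordLeq_iff_ordLess[of \<mu> "|A|"]
      by (auto simp: card_order_on_def card_of_Well_order intro: ordLess_imp_ordLeq)
    then have "infinite A"
      using cinfinite_mono[OF le] mu by (simp add: cinfinite_def Field_card_of)
    then have "|A \<times> ?P| \<le>o |A|"
      by (intro card_of_Times_ordLeq_infinite_Field[OF _ card_of_mono1[OF subset_refl]
            ordLeq_transitive[OF P' le] card_of_Card_order])
        (simp add: Field_card_of)
    then show ?thesis using B ordLeq_transitive by blast
  qed
  then show ?thesis using cof_mod_le_cof_ideal[OF e] A(3) by (metis ordIso_iff_ordLeq)
qed

theorem proposition6p4:
  fixes X :: "'a set" and I :: "'a set set" and \<nu> :: "'a rel" and \<kappa> :: "'k rel"
  assumes "infinite X" and "maximal_ideal_on X I"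
    and "\<nu> = non_ideal X I"
    and "Card_order \<kappa>"
  shows "(natLeq \<le>o \<kappa> \<and> \<kappa> \<le>o \<nu> \<longrightarrow> cardSuc natLeq \<le>o cof_mod (subsets_less X \<kappa>) I) \<and>
    (\<nu> <o \<kappa> \<and> \<kappa> \<le>o |X| \<longrightarrow> cof_mod (subsets_less X \<kappa>) I =o cone) \<and>
    (natLeq \<le>o \<kappa> \<and> weak_power \<nu> \<kappa> <o cof_ideal I \<longrightarrow>
       cof_mod (subsets_less X \<kappa>) I =o cof_ideal I) \<and>
    (cof_star X I =o cof_ideal I \<and> \<nu> <o cof_ideal I)"
proof -
  have I: "ideal_on X I" using assms(2) by (simp add: maximal_ideal_on_def)
  obtain D where D: "D \<subseteq> X" "D \<notin> I" "infinite D" "\<nu> = |D|"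
    using non_ideal_attained[OF I] assms(3) by metis
  have nu: "Cinfinite \<nu>" using D by (simp add: cinfinite_def Field_card_of card_of_card_order_on)
  then have om: "natLeq \<le>o \<nu>" by (rule natLeq_ordLeq_cinfinite)
  have a: "cardSuc natLeq \<le>o cof_mod (subsets_less X \<kappa>) I" if k: "natLeq \<le>o \<kappa>" "\<kappa> \<le>o \<nu>"
  proof -
    have "natLeq <o cof_mod (subsets_less X \<kappa>) I"
      using ordLess_cof_mod[OF assms(2,4)] k assms(3) ordLeq_ordLess_trans by blast
    moreover obtain A where "cof_mod (subsets_less X \<kappa>) I = |A|"
      using cof_mod_attained[OF empty_in_subsets_less[OF k(1)]] by metis
    ultimately show ?thesis
      using cardSuc_ordLess_ordLeq[OF natLeq_Card_order card_of_Card_order[of A]] by simp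
  qed
  have b: "cof_mod (subsets_less X \<kappa>) I =o cone" if "\<nu> <o \<kappa>"
  proof -
    have k: "natLeq \<le>o \<kappa>" using om that ordLeq_transitive ordLess_imp_ordLeq by blast
    obtain A where A: "A \<subseteq> I" "\<forall>S\<in>I. \<exists>T\<in>A. S - T \<in> subsets_less X \<kappa>"
      "cof_mod (subsets_less X \<kappa>) I = |A|"
      using cof_mod_attained[OF empty_in_subsets_less[OF k]] by metis
    have "A \<noteq> {}" using A(2) ideal_on_finite[OF I, of "{}"] by blast
    then have "cone \<le>o |A|" unfolding cone_def by (rule card_of_singl_ordLeq)
    \<comment> \<open>The single set \<open>X - D\<close> suffices: the rest of any \<open>S\<close>
      lies in \<open>D\<close>, which has size \<open>\<nu> <o \<kappa>\<close>.\<close>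
    moreover have "cof_mod (subsets_less X \<kappa>) I \<le>o |{X - D}|"
    proof (rule cof_mod_le)
      show "{X - D} \<subseteq> I" using maximal_ideal_on_Diff[OF assms(2) D(1,2)] by simp
      fix S assume "S \<in> I"
      then have S: "S \<subseteq> X" by (rule ideal_on_carrier[OF I])
      then have "|S - (X - D)| \<le>o |D|" by (intro card_of_mono1) auto
      then have "|S - (X - D)| <o \<kappa>" using that D(4) ordLeq_ordLess_trans by blast
      then show "\<exists>T\<in>{X - D}. S - T \<in> subsets_less X \<kappa>"
        using S by (auto simp: subsets_less_def)
    qed
    moreover have "|{X - D}| \<le>o cone" unfolding cone_def by (rule card_of_singl_ordLeq) simp
    ultimately show ?thesis using A(3) ordLeq_transitive ordIso_iff_ordLeq by metis
  qed
  have c: "cof_mod (subsets_less X \<kappa>) I =o cof_ideal I"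
    if k: "natLeq \<le>o \<kappa>" and less: "weak_power \<nu> \<kappa> <o cof_ideal I"
  proof (rule cof_mod_eq_cof_ideal[OF assms(2) D(1,2) k _ _ less])
    show P: "|subsets_less D \<kappa>| \<le>o weak_power \<nu> \<kappa>"
      unfolding D(4) by (rule card_of_subsets_less[OF k assms(4) D(3)])
    \<comment> \<open>With base at least two, the weak power dominates \<open>\<kappa>\<close> and
      is therefore infinite.\<close>
    have "ctwo \<le>o \<nu>" using nu by (rule ctwo_ordLeq_Cinfinite)
    then have "natLeq \<le>o weak_power \<nu> \<kappa>"
      using ordLeq_weak_power nu assms(4) k ordLeq_transitive by blast
    then show "Cinfinite (weak_power \<nu> \<kappa>)"
      using cinfinite_mono natLeq_cinfinite Card_order_weak_power by blast
  qed
  \<comment> \<open>The modulus has threshold \<open>\<nu>\<close> here, independently of the given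
    \<open>\<kappa>\<close>.\<close>
  have d: "\<nu> <o cof_ideal I"
    using ordLess_cof_mod[OF assms(2), of \<nu>] nu om assms(3) ordLeq_refl
      cof_mod_le_cof_ideal[OF empty_in_subsets_less[OF om]] ordLess_ordLeq_trans by metis
  have "cof_star X I =o cof_ideal I"
    unfolding cof_star_def
  \<comment> \<open>The bound \<open>\<mu>\<close> is \<open>\<nu>\<close> itself instead of a weak
    power, and \<open>d\<close> supplies the strict inequality.\<close>
  proof (rule cof_mod_eq_cof_ideal[OF assms(2) D(1,2) _ nu _ d])
    show "natLeq \<le>o natLeq" by (rule ordLeq_refl[OF natLeq_Card_order])
    have "subsets_less D natLeq = {F. F \<subseteq> D \<and> finite F}"
      by (auto simp: subsets_less_def finite_iff_ordLess_natLeq)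
    then show "|subsets_less D natLeq| \<le>o \<nu>"
      unfolding D(4) using card_of_finite_subsets[OF D(3)] by simp
  qed
  then show ?thesis using a b c d by blast
qed

end
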